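(* For every integer $n\geq 6$ we have $\mathrm{sat}^*(n,\mathcal A_6)=5n-5$.
   Context: A family $\mathcal F$ of subsets of $[n]=\{1,\ldots,n\}$ is called $k$-antichain saturated if $\mathcal F$ does not contain $k$ pairwise incomparable (with respect to inclusion) sets, but for every set $X\subseteq[n]$ with $X\notin\mathcal F$, the family $\mathcal F\cup\{X\}$ contains $k$ pairwise incomparable sets. $\mathrm{sat}^*(n,\mathcal A_k)$ denotes the minimum size of a $k$-antichain saturated family of subsets of $[n]$. *)

theory Defs
  imports Main
begin

definition incomparable :: "'a set \<Rightarrow> 'a set \<Rightarrow> bool" where
  "incomparable A B \<longleftrightarrow> \<not> A \<subseteq> B \<and> \<not> B \<subseteq> A"

definition contains_antichain :: "nat \<Rightarrow> 'a set set \<Rightarrow> bool" where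
  "contains_antichain k F \<longleftrightarrow> (\<exists>C\<subseteq>F. finite C \<and> card C = k \<and> pairwise incomparable C)"

definition antichain_saturated :: "nat \<Rightarrow> nat \<Rightarrow> nat set set \<Rightarrow> bool" where
  "antichain_saturated n k F \<longleftrightarrow>
     F \<subseteq> Pow {1..n} \<and>
     \<not> contains_antichain k F \<and>
     (\<forall>X. X \<subseteq> {1..n} \<and> X \<notin> F \<longrightarrow> contains_antichain k (insert X F))"

definition sat_star :: "nat \<Rightarrow> nat \<Rightarrow> nat" where
  "sat_star n k = Min {card F | F. antichain_saturated n k F}"

text \<open>\<open>Min\<close> is unspecified on empty and on infinite sets; neither occurs for \<open>k \<ge> 1\<close>.\<close>

lemma finite_saturated_sizes: "finite {card F | F. antichain_saturated n k F}"
proof -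
  have "{card F | F. antichain_saturated n k F} \<subseteq> card ` Pow (Pow {1..n})"
    by (auto simp: antichain_saturated_def)
  then show ?thesis
    by (rule finite_subset) simp
qed

lemma saturated_sizes_nonempty:
  assumes "k \<ge> 1"
  shows "{card F | F. antichain_saturated n k F} \<noteq> {}"
proof -
  define A where "A = {F. F \<subseteq> Pow {1..n} \<and> \<not> contains_antichain k F}"
  have "finite A"
    by (rule finite_subset[of _ "Pow (Pow {1..n})"]) (auto simp: A_def)
  moreover have "{} \<in> A"
    using assms by (auto simp: A_def contains_antichain_def)
  ultimately obtain F where F: "F \<in> A" and max: "\<forall>G\<in>A. F \<subseteq> G \<longrightarrow> F = G"
    using finite_has_maximal[of A] by blast
  have "contains_antichain k (insert X F)" if X: "X \<subseteq> {1..n}" "X \<notin> F" for X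
  proof (rule ccontr)
    assume "\<not> contains_antichain k (insert X F)"
    with F X have "insert X F \<in> A"
      by (simp add: A_def)
    with max have "F = insert X F"
      by blast
    with X show False
      by blast
  qed
  with F have "antichain_saturated n k F"
    by (simp add: A_def antichain_saturated_def)
  then show ?thesis
    by blast
qed

end

theory Submission
  imports Defs
begin

text \<open>The extremal families have \<open>1, 4, 5, \<dots>, 5, 4, 1\<close> sets of sizes \<open>0, 1, \<dots>, n\<close>.

  Lower bound: by Dilworth, a saturated family \<open>F\<close> is a union of five chains. Its lowest
  five-element antichain has its whole down-closure in \<open>F\<close>, because a missing set in the
  down-closure is comparable to a member of every five-element antichain. So there are at least four
  singletons in \<open>F\<close> (a three-element set has no five-element antichain of subsets), and if there
  are exactly four, then this antichain consists of five pairs. Hence level 1 or level 2 has five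
  members, and dually for level \<open>n - 1\<close> or \<open>n - 2\<close>. Between two levels with five members every
  level has five members: if the chains meet level \<open>i\<close> in sets \<open>U j\<close> and their next members beyond
  level \<open>i + 1\<close> are \<open>V j\<close>, then Hall's theorem gives distinct sets of size \<open>i + 1\<close> between
  \<open>U j\<close> and \<open>V j\<close>, and they can be chosen to include all members of \<open>F\<close> of that size. The
  family enlarged by these sets is still a union of five chains, so by saturation it is \<open>F\<close>.

  Upper bound: a level is an antichain, so it has at most five members, and it suffices to
  keep levels \<open>1\<close> and \<open>n - 1\<close> small.\<close>

section \<open>Dilworth's theorem\<close>

text \<open>A partition of \<open>F\<close> into at most \<open>k\<close> chains, encoded by the
  chain index of each member, so that restriction to a subfamily keeps the function.\<close>

definition chain_colouring :: "nat \<Rightarrow> ('a set \<Rightarrow> nat) \<Rightarrow> 'a set set \<Rightarrow> bool" where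
  "chain_colouring k c F \<longleftrightarrow>
     (\<forall>X\<in>F. c X < k) \<and> (\<forall>X\<in>F. \<forall>Y\<in>F. c X = c Y \<longrightarrow> X \<subseteq> Y \<or> Y \<subseteq> X)"

definition level :: "'a set set \<Rightarrow> nat \<Rightarrow> 'a set set" where
  "level F i = {X \<in> F. card X = i}"

lemma contains_antichain_mono:
  "contains_antichain k F \<Longrightarrow> F \<subseteq> G \<Longrightarrow> contains_antichain k G"
  unfolding contains_antichain_def by (metis order_trans)

lemma inj_on_chain_colouring:
  assumes "chain_colouring k c F" "C \<subseteq> F" "pairwise incomparable C"
  shows "inj_on c C"
  using assms unfolding chain_colouring_def inj_on_def pairwise_def incomparable_def
  by (metis subsetD)

lemma antichain_card_le:
  assumes "chain_colouring k c F" "C \<subseteq> F" "pairwise incomparable C"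
  shows "card C \<le> k"
proof -
  have "c ` C \<subseteq> {..<k}"
    using assms unfolding chain_colouring_def by blast
  then have "card C \<le> card {..<k}"
    by (intro card_inj_on_le[OF inj_on_chain_colouring[OF assms]]) auto
  then show ?thesis by simp
qed

lemma chain_colouring_imp_no_antichain:
  "chain_colouring k c F \<Longrightarrow> \<not> contains_antichain (Suc k) F"
  using antichain_card_le unfolding contains_antichain_def by (metis Suc_n_not_le_n)

text \<open>By injectivity on antichains, \<open>k\<close> members use \<open>k\<close> distinct
  colours, hence all of them. This supplies a member on any prescribed chain in every
  \<open>k\<close>-element antichain.\<close>

lemma maximum_antichain_colours:
  assumes "chain_colouring k c F" "C \<subseteq> F" "pairwise incomparable C" "card C = k"
  shows "c ` C = {..<k}"
proof -
  have "c ` C \<subseteq> {..<k}"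
    using assms unfolding chain_colouring_def by blast
  moreover have "card (c ` C) = card {..<k}"
    using card_image[OF inj_on_chain_colouring[OF assms(1-3)]] assms(4) by simp
  ultimately show ?thesis
    by (simp add: card_subset_eq)
qed

lemma antichain_of_card_ge:
  assumes "C \<subseteq> F" "pairwise incomparable C" "k \<le> card C"
  shows "contains_antichain k F"
proof -
  obtain D where "D \<subseteq> C" "card D = k" "finite D"
    using obtain_subset_with_card_n[OF assms(3)] by metis
  moreover from this have "pairwise incomparable D"
    using assms(2) pairwise_subset by blast
  ultimately show ?thesis
    using assms(1) unfolding contains_antichain_def by blast
qed

text \<open>The top of the lattice of \<open>k\<close>-element antichains: \<open>A i\<close> is the
  largest set of colour \<open>i\<close> that occurs in such an antichain. If
  \<open>A i \<subseteq> A j\<close>, then a \<open>k\<close>-element antichain through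
  \<open>A j\<close> has a member of colour \<open>i\<close>, which lies below \<open>A i\<close>
  and thus below \<open>A j\<close>, a contradiction.\<close>

lemma ex_top_antichain:
  assumes F: "finite F" "\<forall>X\<in>F. finite X" and c: "chain_colouring k c F" and "contains_antichain k F"
  obtains A where "\<And>i. i < k \<Longrightarrow> A i \<in> F" "\<And>i. i < k \<Longrightarrow> c (A i) = i"
    "\<And>i j. i < k \<Longrightarrow> j < k \<Longrightarrow> i \<noteq> j \<Longrightarrow> incomparable (A i) (A j)"
    "\<And>B b. B \<subseteq> F \<Longrightarrow> pairwise incomparable B \<Longrightarrow> card B = k \<Longrightarrow> b \<in> B \<Longrightarrow> b \<subseteq> A (c b)"
proof -
  define M where "M i = {b. \<exists>B. B \<subseteq> F \<and> pairwise incomparable B \<and> card B = k \<and> b \<in> B \<and> c b = i}" for i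
  have MF: "M i \<subseteq> F" for i
    unfolding M_def by blast
  obtain B0 where B0: "B0 \<subseteq> F" "pairwise incomparable B0" "card B0 = k"
    using assms(4) unfolding contains_antichain_def by blast
  have ne: "M i \<noteq> {}" if "i < k" for i
  proof -
    have "i \<in> c ` B0"
      using maximum_antichain_colours[OF c B0] that by simp
    then show ?thesis
      using B0 unfolding M_def by blast
  qed
  have ex: "\<exists>a. a \<in> M i \<and> (\<forall>b\<in>M i. b \<subseteq> a)" if i: "i < k" for i
  proof -
    have "finite (M i)"
      using MF F(1) by (rule finite_subset)
    then obtain a where a: "a \<in> M i" "\<forall>b\<in>M i. a \<subseteq> b \<longrightarrow> a = b"
      using finite_has_maximal[of "M i"] ne[OF i] by blast
    have "b \<subseteq> a" if "b \<in> M i" for b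
    proof -
      have "c a = c b" "a \<in> F" "b \<in> F"
        using a(1) that unfolding M_def by auto
      then have "a \<subseteq> b \<or> b \<subseteq> a"
        using c unfolding chain_colouring_def by blast
      then show ?thesis
        using a(2) that by blast
    qed
    with a(1) show ?thesis by blast
  qed
  define A where "A i = (SOME a. a \<in> M i \<and> (\<forall>b\<in>M i. b \<subseteq> a))" for i
  have A: "A i \<in> M i" "\<And>b. b \<in> M i \<Longrightarrow> b \<subseteq> A i" if "i < k" for i
    using someI_ex[OF ex[OF that]] unfolding A_def by blast+
  have nsub: "\<not> A i \<subseteq> A j" if ij: "i < k" "j < k" "i \<noteq> j" for i j
  proof
    assume sub: "A i \<subseteq> A j"
    obtain B where B: "B \<subseteq> F" "pairwise incomparable B" "card B = k" "A j \<in> B" "c (A j) = j"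
      using A(1)[OF ij(2)] unfolding M_def by blast
    have "i \<in> c ` B"
      using maximum_antichain_colours[OF c B(1-3)] ij by simp
    then obtain b where b: "b \<in> B" "c b = i" by blast
    then have "b \<in> M i"
      using B unfolding M_def by blast
    then have "b \<subseteq> A j"
      using A(2)[OF ij(1)] sub by blast
    moreover have "b \<noteq> A j"
      using b B(5) ij(3) by blast
    ultimately show False
      using B(2,4) b(1) unfolding pairwise_def incomparable_def by blast
  qed
  show thesis
  proof
    show "A i \<in> F" if "i < k" for i
      using A(1)[OF that] MF by blast
    show "c (A i) = i" if "i < k" for i
      using A(1)[OF that] unfolding M_def by blast
    show "incomparable (A i) (A j)" if "i < k" "j < k" "i \<noteq> j" for i j
      using nsub that unfolding incomparable_def by blast
    show "b \<subseteq> A (c b)" if "B \<subseteq> F" "pairwise incomparable B" "card B = k" "b \<in> B" for B b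
    proof (rule A(2))
      show "c b < k"
        using that c unfolding chain_colouring_def by blast
      show "b \<in> M (c b)"
        using that unfolding M_def by blast
    qed
  qed
qed

text \<open>Galvin's argument: a maximal element \<open>a\<close> is removed, and if it lies above some \<open>A i\<close> of the
  top antichain of the rest, then \<open>a\<close> together with the part of the \<open>i\<close>-th chain below \<open>A i\<close> is a chain whose removal decreases the width.\<close>

theorem dilworth_chain_colouring:
  assumes "finite F" "\<forall>X\<in>F. finite X" "\<not> contains_antichain (Suc k) F"
  shows "\<exists>c. chain_colouring k c F"
  using assms
proof (induction "card F" arbitrary: F k rule: less_induct)
  case less
  show ?case
  proof (cases "F = {}")
    case True
    then show ?thesis
      by (simp add: chain_colouring_def)
  next
    case False
    obtain a where a: "a \<in> F" "\<forall>b\<in>F. a \<subseteq> b \<longrightarrow> a = b"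
      using finite_has_maximal[OF less.prems(1) False] by blast
    define F' where "F' = F - {a}"
    have F': "F' \<subseteq> F" "finite F'" "\<forall>X\<in>F'. finite X" "card F' < card F"
      using less.prems card_Diff1_less[OF less.prems(1) a(1)] unfolding F'_def by auto
    have k0: "k \<noteq> 0" if "\<not> contains_antichain k G" for G :: "'a set set"
    proof
      assume "k = 0"
      then have "contains_antichain k G"
        unfolding contains_antichain_def by (intro exI[of _ "{}"]) auto
      with that show False ..
    qed
    \<comment> \<open>Deleting a chain \<open>K\<close> that meets every \<open>k\<close>-element
      antichain lowers the width bound, so induction colours the rest with \<open>m = k - 1\<close>
      colours, and \<open>K\<close> receives the new colour \<open>m\<close>.\<close>
    have extend: ?thesis if K: "K \<subseteq> F" "K \<noteq> {}" "\<forall>X\<in>K. \<forall>Y\<in>K. X \<subseteq> Y \<or> Y \<subseteq> X"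
      and nk: "\<not> contains_antichain k (F - K)" for K
    proof -
      obtain m where m: "k = Suc m"
        using k0[OF nk] not0_implies_Suc by blast
      have "card (F - K) < card F"
        using K less.prems(1) by (intro psubset_card_mono) auto
      then obtain c where c: "chain_colouring m c (F - K)"
        using less.hyps[of "F - K" m] less.prems nk m by auto
      then have "c X < m" "c X \<noteq> m" if "X \<in> F" "X \<notin> K" for X
        using that unfolding chain_colouring_def by auto
      then have "chain_colouring k (\<lambda>X. if X \<in> K then m else c X) F"
        using K(3) c unfolding chain_colouring_def m by (auto simp: less_Suc_eq)
      then show ?thesis by blast
    qed
    show ?thesis
    proof (cases "contains_antichain k F'")
      case False
      then show ?thesis
        using extend[of "{a}"] a(1) unfolding F'_def by auto
    next
      case True
      have "\<not> contains_antichain (Suc k) F'"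
        using less.prems(3) contains_antichain_mono F'(1) by blast
      then obtain c where c: "chain_colouring k c F'"
        using less.hyps[of F' k] F' by blast
      obtain A where A: "\<And>i. i < k \<Longrightarrow> A i \<in> F'" "\<And>i. i < k \<Longrightarrow> c (A i) = i"
        "\<And>i j. i < k \<Longrightarrow> j < k \<Longrightarrow> i \<noteq> j \<Longrightarrow> incomparable (A i) (A j)"
        "\<And>B b. B \<subseteq> F' \<Longrightarrow> pairwise incomparable B \<Longrightarrow> card B = k \<Longrightarrow> b \<in> B \<Longrightarrow> b \<subseteq> A (c b)"
        using ex_top_antichain[OF F'(2,3) c True] by blast
      \<comment> \<open>Otherwise maximality of \<open>a\<close> makes it incomparable to every
        \<open>A i\<close>, which gives \<open>Suc k\<close> incomparable sets.\<close>
      have "\<exists>i<k. A i \<subseteq> a"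
      proof (rule ccontr)
        assume no: "\<not> ?thesis"
        have inc: "incomparable a (A i)" if "i < k" for i
          using no that A(1)[OF that] a(2) unfolding incomparable_def F'_def by blast
        have "inj_on A {..<k}"
          by (rule inj_on_inverseI[of _ c]) (simp add: A(2))
        then have "card (A ` {..<k}) = k"
          by (simp add: card_image)
        moreover have "a \<notin> A ` {..<k}"
          using A(1) unfolding F'_def by blast
        ultimately have "card (insert a (A ` {..<k})) = Suc k"
          by simp
        moreover have "pairwise incomparable (A ` {..<k})"
          by (auto simp: pairwise_def intro!: A(3))
        then have "pairwise incomparable (insert a (A ` {..<k}))"
          using inc by (auto simp: pairwise_insert incomparable_def)
        moreover have "insert a (A ` {..<k}) \<subseteq> F"
          using A(1) a(1) F'(1) by auto
        ultimately have "contains_antichain (Suc k) F"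
          by (intro antichain_of_card_ge) auto
        with less.prems(3) show False by blast
      qed
      then obtain i where i: "i < k" "A i \<subseteq> a" by blast
      define K where "K = insert a {X \<in> F'. c X = i \<and> X \<subseteq> A i}"
      show ?thesis
      proof (rule extend)
        show "K \<subseteq> F" "K \<noteq> {}"
          using a(1) F'(1) by (auto simp: K_def)
        show "\<forall>X\<in>K. \<forall>Y\<in>K. X \<subseteq> Y \<or> Y \<subseteq> X"
          using c i(2) unfolding K_def chain_colouring_def by blast
        show "\<not> contains_antichain k (F - K)"
        proof
          assume "contains_antichain k (F - K)"
          then obtain B where B: "B \<subseteq> F - K" "card B = k" "pairwise incomparable B"
            unfolding contains_antichain_def by blast
          have BF: "B \<subseteq> F'"
            using B(1) unfolding K_def F'_def by blast
          have "i \<in> c ` B"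
            using maximum_antichain_colours[OF c BF B(3,2)] i(1) by simp
          then obtain b where b: "b \<in> B" "c b = i" by blast
          then have "b \<in> K"
            using A(4)[OF BF B(3,2)] BF unfolding K_def by auto
          with b(1) B(1) show False by blast
        qed
      qed
    qed
  qed
qed

section \<open>Transversals\<close>

text \<open>Rado's argument: in an inclusion-minimal system satisfying Hall's condition
  every set is a singleton.\<close>

theorem hall_transversal:
  fixes N :: "'i \<Rightarrow> 'b set"
  assumes "finite J" "\<And>j. j \<in> J \<Longrightarrow> finite (N j)"
    and "\<And>I. I \<subseteq> J \<Longrightarrow> card I \<le> card (\<Union> (N ` I))"
  shows "\<exists>h. inj_on h J \<and> (\<forall>j\<in>J. h j \<in> N j)"
  using assms(2,3)
proof (induction "\<Sum>j\<in>J. card (N j)" arbitrary: N rule: less_induct)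
  case less
  note fin = less.prems(1) and hall = less.prems(2)
  have ne: "N j \<noteq> {}" if "j \<in> J" for j
    using hall[of "{j}"] that by auto
  have finJ: "finite I" if "I \<subseteq> J" for I
    using that assms(1) finite_subset by blast
  have finU: "finite (\<Union> (N ` I))" if "I \<subseteq> J" for I
    using that finJ[OF that] fin by blast
  show ?case
  proof (cases "\<forall>j\<in>J. card (N j) = 1")
    case True
    then have "\<forall>j\<in>J. \<exists>x. N j = {x}"
      by (simp add: card_1_singleton_iff)
    then obtain h where h: "\<forall>j\<in>J. N j = {h j}"
      by metis
    have "inj_on h J"
    proof (rule inj_onI, rule ccontr)
      fix i j assume ij: "i \<in> J" "j \<in> J" "h i = h j" "i \<noteq> j"
      then have "\<Union> (N ` {i, j}) = {h j}"
        using h by auto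
      with hall[of "{i, j}"] ij show False by simp
    qed
    with h show ?thesis by blast
  next
    case False
    then obtain j where j: "j \<in> J" "card (N j) \<noteq> 1" by blast
    moreover have "card (N j) \<noteq> 0"
      using ne fin j by simp
    ultimately have "card (N j) \<ge> 2" by linarith
    then obtain x y where xy: "x \<in> N j" "y \<in> N j" "x \<noteq> y"
      by (metis card_le_Suc0_iff_eq fin j(1) not_less_eq_eq numeral_2_eq_2)
    \<comment> \<open>Removing \<open>z\<close> from \<open>N j\<close> decreases the induction
      measure. If the result satisfied Hall's condition, induction would give a transversal; hence
      some \<open>insert j I\<close> has too few neighbours.\<close>
    have violator: "\<exists>I. I \<subseteq> J - {j} \<and> card (\<Union> (N ` I) \<union> (N j - {z})) \<le> card I"
      if z: "z \<in> N j" and nothesis: "\<not> ?thesis" for z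
    proof (rule ccontr)
      assume no: "\<not> (\<exists>I. I \<subseteq> J - {j} \<and> card (\<Union> (N ` I) \<union> (N j - {z})) \<le> card I)"
      define N' where "N' = N(j := N j - {z})"
      have "(\<Sum>i\<in>J. card (N' i)) < (\<Sum>i\<in>J. card (N i))"
        using j(1) card_Diff1_less[OF fin[OF j(1)] z] assms(1) unfolding N'_def
        by (intro sum_strict_mono_ex1) (auto intro!: bexI[of _ j] simp: card_Diff1_le)
      moreover have "finite (N' i)" if "i \<in> J" for i
        using fin[OF that] fin[OF j(1)] by (simp add: N'_def)
      moreover have "card I \<le> card (\<Union> (N' ` I))" if I: "I \<subseteq> J" for I
      proof (cases "j \<in> I")
        case True
        have "\<Union> (N' ` I) = \<Union> (N ` (I - {j})) \<union> (N j - {z})"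
          using True by (auto simp: N'_def split: if_splits)
        moreover have "\<not> card (\<Union> (N ` (I - {j})) \<union> (N j - {z})) \<le> card (I - {j})"
          using no Diff_mono[OF I order_refl] by blast
        moreover have "card I = Suc (card (I - {j}))"
          using card_Suc_Diff1[OF finJ[OF I] True] by simp
        ultimately show ?thesis by simp
      next
        case False
        then have "\<Union> (N' ` I) = \<Union> (N ` I)"
          by (auto simp: N'_def)
        with hall[OF I] show ?thesis by simp
      qed
      ultimately obtain h where h: "inj_on h J" "\<forall>i\<in>J. h i \<in> N' i"
        using less.hyps[of N'] by blast
      then have "\<forall>i\<in>J. h i \<in> N i"
        by (auto simp: N'_def split: if_splits)
      with h(1) nothesis show False by blast
    qed
    show ?thesis
    proof (rule ccontr)
      assume nothesis: "\<not> ?thesis"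
      obtain I where I: "I \<subseteq> J - {j}" "card (\<Union> (N ` I) \<union> (N j - {x})) \<le> card I"
        using violator[OF xy(1) nothesis] by blast
      obtain K where K: "K \<subseteq> J - {j}" "card (\<Union> (N ` K) \<union> (N j - {y})) \<le> card K"
        using violator[OF xy(2) nothesis] by blast
      define P where "P = \<Union> (N ` I) \<union> (N j - {x})"
      define Q where "Q = \<Union> (N ` K) \<union> (N j - {y})"
      have IK: "I \<subseteq> J" "K \<subseteq> J" "I \<inter> K \<subseteq> J" "insert j (I \<union> K) \<subseteq> J" "j \<notin> I \<union> K"
        using I(1) K(1) j(1) by auto
      have finPQ: "finite P" "finite Q"
        using finU IK(1,2) fin[OF j(1)] by (auto simp: P_def Q_def)
      \<comment> \<open>Submodularity: as \<open>x \<noteq> y\<close>, the neighbours of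
        \<open>insert j (I \<union> K)\<close> lie in \<open>P \<union> Q\<close>, and those of
        \<open>I \<inter> K\<close> in \<open>P \<inter> Q\<close>. So
        \<open>card P + card Q\<close> is at least \<open>card I + card K + 1\<close>, against the
        choice of \<open>I\<close> and \<open>K\<close>.\<close>
      have "\<Union> (N ` insert j (I \<union> K)) \<subseteq> P \<union> Q"
        using xy by (auto simp: P_def Q_def)
      then have "card (insert j (I \<union> K)) \<le> card (P \<union> Q)"
        using hall[OF IK(4)] finPQ card_mono[of "P \<union> Q"] by (meson finite_Un le_trans)
      moreover have "card (insert j (I \<union> K)) = Suc (card (I \<union> K))"
        using IK finJ by simp
      moreover have "\<Union> (N ` (I \<inter> K)) \<subseteq> P \<inter> Q"
        by (auto simp: P_def Q_def)
      then have "card (I \<inter> K) \<le> card (P \<inter> Q)"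
        using hall[OF IK(3)] finPQ card_mono[of "P \<inter> Q"] by (meson finite_Int le_trans)
      moreover have "card P + card Q = card (P \<union> Q) + card (P \<inter> Q)"
        using finPQ by (rule card_Un_Int)
      moreover have "card I + card K = card (I \<union> K) + card (I \<inter> K)"
        using finJ IK(1,2) by (intro card_Un_Int) auto
      ultimately show False
        using I(2) K(2) unfolding P_def[symmetric] Q_def[symmetric] by linarith
    qed
  qed
qed

text \<open>Replacing \<open>h (g z)\<close> by \<open>z\<close> whenever \<open>z\<close> is missed increases the agreement with \<open>g\<close>.\<close>

lemma transversal_covering:
  fixes N :: "'i \<Rightarrow> 'b set"
  assumes J: "finite J" and h: "inj_on h J" "\<forall>j\<in>J. h j \<in> N j"
    and g: "inj_on g Z" "g ` Z \<subseteq> J" "\<forall>z\<in>Z. z \<in> N (g z)"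
  shows "\<exists>h. inj_on h J \<and> (\<forall>j\<in>J. h j \<in> N j) \<and> Z \<subseteq> h ` J"
proof -
  define P where "P h \<longleftrightarrow> inj_on h J \<and> (\<forall>j\<in>J. h j \<in> N j)" for h :: "'i \<Rightarrow> 'b"
  define agr where "agr h = {z \<in> Z. h (g z) = z}" for h :: "'i \<Rightarrow> 'b"
  have finZ: "finite Z"
    using g J inj_on_finite by blast
  have "\<exists>h. P h \<and> (\<forall>h'. P h' \<longrightarrow> card (agr h') \<le> card (agr h))"
  proof (rule ex_has_greatest_nat)
    show "P h" using h by (simp add: P_def)
    show "\<forall>h'. P h' \<longrightarrow> card (agr h') < Suc (card Z)"
      using finZ by (auto simp: agr_def less_Suc_eq_le intro: card_mono)
  qed
  then obtain h where h: "P h" and max: "\<And>h'. P h' \<Longrightarrow> card (agr h') \<le> card (agr h)" by blast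
  have "z \<in> h ` J" if z: "z \<in> Z" for z
  proof (rule ccontr)
    assume notin: "z \<notin> h ` J"
    define h' where "h' = h(g z := z)"
    have gz: "g z \<in> J" using z g by blast
    have "P h'"
      using h notin z g(3) unfolding P_def h'_def inj_on_def by (auto simp: image_iff)
    moreover have "agr h \<subset> agr h'"
    proof -
      have "z \<in> agr h' - agr h"
        using z notin gz by (auto simp: agr_def h'_def image_iff)
      moreover have "agr h \<subseteq> agr h'"
        using g(1) z notin gz by (auto simp: agr_def h'_def inj_on_def)
      ultimately show ?thesis by blast
    qed
    then have "card (agr h) < card (agr h')"
      using finZ by (intro psubset_card_mono) (auto simp: agr_def)
    ultimately show False
      using max[of h'] by simp
  qed
  then show ?thesis
    using h unfolding P_def by blast
qed

section \<open>Levels of a saturated family\<close>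

text \<open>Each pair of points lies in at most one \<open>N j\<close>, so the pairs inside the
  \<open>N j\<close> number at most \<open>card W choose 2\<close>, where \<open>W\<close> is the
  union. With at most five sets this leaves one possible failure, five two-element sets on four
  points, and five of the six edges on four points contain a triangle.\<close>

lemma card_le_card_Union_of_linear:
  fixes N :: "'i \<Rightarrow> 'b set"
  assumes J: "finite J" "card J \<le> 5"
    and fin: "\<And>j. j \<in> J \<Longrightarrow> finite (N j)" and two: "\<And>j. j \<in> J \<Longrightarrow> 2 \<le> card (N j)"
    and linear: "\<And>j k. j \<in> J \<Longrightarrow> k \<in> J \<Longrightarrow> j \<noteq> k \<Longrightarrow> card (N j \<inter> N k) \<le> 1"
    and no_triangle: "\<And>j k l p q r. {j, k, l} \<subseteq> J \<Longrightarrow> N j = {p, q} \<Longrightarrow> N k = {q, r} \<Longrightarrow>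
      N l = {p, r} \<Longrightarrow> p \<noteq> q \<Longrightarrow> q \<noteq> r \<Longrightarrow> p \<noteq> r \<Longrightarrow> False"
  shows "card J \<le> card (\<Union> (N ` J))"
proof (rule ccontr)
  define W where "W = \<Union> (N ` J)"
  assume "\<not> card J \<le> card (\<Union> (N ` J))"
  then have less: "card W < card J"
    by (simp add: W_def)
  have finW: "finite W"
    using J fin by (simp add: W_def)
  define prs where "prs A = {e. e \<subseteq> A \<and> card e = 2}" for A :: "'b set"
  have card_prs: "card (prs A) = card A choose 2" if "finite A" for A
    unfolding prs_def using n_subsets[OF that] .
  have fin_prs: "finite (prs A)" if "finite A" for A
    unfolding prs_def using that by simp
  have disj: "prs (N j) \<inter> prs (N k) = {}" if jk: "j \<in> J" "k \<in> J" "j \<noteq> k" for j k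
  proof (rule ccontr)
    assume "\<not> ?thesis"
    then obtain e where e: "e \<subseteq> N j \<inter> N k" "card e = 2"
      unfolding prs_def by blast
    then have "card e \<le> card (N j \<inter> N k)"
      using fin jk by (intro card_mono) auto
    with linear[OF jk] e(2) show False by simp
  qed
  have "(\<Sum>j\<in>J. card (N j) choose 2) = card (\<Union>j\<in>J. prs (N j))"
    using J fin fin_prs disj by (subst card_UN_disjoint) (auto simp: card_prs)
  also have "\<dots> \<le> card (prs W)"
    by (intro card_mono fin_prs finW) (auto simp: prs_def W_def)
  finally have sum_le: "(\<Sum>j\<in>J. card (N j) choose 2) \<le> card W choose 2"
    using card_prs[OF finW] by simp
  have ge1: "1 \<le> card (N j) choose 2" if "j \<in> J" for j
    using two[OF that] zero_less_binomial[of 2 "card (N j)"] by linarith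
  have "card J \<le> (\<Sum>j\<in>J. card (N j) choose 2)"
    using sum_mono[of J "\<lambda>_. 1" "\<lambda>j. card (N j) choose 2"] ge1 by simp
  with sum_le have J_le: "card J \<le> card W choose 2" by linarith
  \<comment> \<open>For \<open>card W\<close> equal to 0, 1, 2, 3 there are 0, 0, 1, 3 pairs, fewer
    than the required \<open>card W + 1\<close>.\<close>
  have "card W \<in> {0, 1, 2, 3, 4}"
    using less J(2) by auto
  then have cards: "card W = 4" "card J = 5"
    using J_le less J(2) by (auto simp: choose_two)
  \<comment> \<open>The other four sets use at least four of the six pairs, so \<open>N j\<close>
    contains at most two pairs, whereas three points would give three.\<close>
  have N2: "card (N j) = 2" if j: "j \<in> J" for j
  proof -
    have "card (J - {j}) \<le> (\<Sum>k\<in>J - {j}. card (N k) choose 2)"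
      using sum_mono[of "J - {j}" "\<lambda>_. 1" "\<lambda>j. card (N j) choose 2"] ge1 by simp
    then have "(card (N j) choose 2) + 4 \<le> (\<Sum>k\<in>J. card (N k) choose 2)"
      using sum.remove[OF J(1) j, of "\<lambda>k. card (N k) choose 2"] cards j by simp
    then have "card (N j) choose 2 \<le> 2"
      using sum_le cards by (simp add: choose_two)
    moreover have "card (N j) \<le> 4"
      using card_mono[OF finW, of "N j"] j cards by (auto simp: W_def)
    then have "card (N j) \<in> {2, 3, 4}"
      using two[OF j] by auto
    ultimately show ?thesis
      by (auto simp: choose_two)
  qed
  define E where "E = N ` J"
  have "inj_on N J"
    using linear N2 by (force simp: inj_on_def)
  then have cardE: "card E = 5"
    using cards by (simp add: E_def card_image)
  have "E \<subseteq> prs W"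
    using N2 by (auto simp: E_def prs_def W_def)
  moreover have "card (prs W) = 6"
    using card_prs[OF finW] cards by (simp add: choose_two)
  ultimately have "card (prs W - E) = 1"
    using cardE fin_prs[OF finW] by (simp add: card_Diff_subset finite_subset)
  then obtain e where e: "prs W - E = {e}"
    using card_1_singletonE by blast
  have "e \<subseteq> W" "card e = 2"
    using e unfolding prs_def by auto
  moreover from this obtain x y where xy: "e = {x, y}" "x \<noteq> y"
    by (auto simp: card_2_iff)
  moreover have "card (W - e) = 2"
    using calculation cards by (simp add: card_Diff_subset)
  then obtain u v where uv: "W - e = {u, v}" "u \<noteq> v"
    by (auto simp: card_2_iff)
  ultimately have mem: "x \<in> W" "u \<in> W" "v \<in> W" "x \<noteq> u" "x \<noteq> v" "u \<notin> e" "v \<notin> e"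
    by blast+
  have edge: "\<exists>j\<in>J. N j = {w, z}" if "w \<in> W - e" "z \<in> W" "w \<noteq> z" for w z
  proof -
    have "{w, z} \<in> prs W" "{w, z} \<noteq> e"
      using that by (auto simp: prs_def)
    then have "{w, z} \<in> E"
      using e by (metis DiffI singletonD)
    then show ?thesis
      unfolding E_def by (metis imageE)
  qed
  obtain j k l where "{j, k, l} \<subseteq> J" "N j = {u, v}" "N k = {v, x}" "N l = {u, x}"
    using edge[of u v] edge[of v x] edge[of u x] mem uv(2) by auto
  then show False
    using no_triangle[of j k l u v x] uv(2) mem by simp
qed

text \<open>Two of the layers meet at most in \<open>U j \<union> U k\<close>, and three layers forming a triangle of
  two-element sets would have the same upper ends \<open>V j = U j \<union> U k \<union> U l\<close>.\<close>

lemma card_le_card_intermediate_layer: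
  fixes U V :: "'i \<Rightarrow> 'a set"
  assumes J: "finite J" "card J \<le> 5" and inj: "inj_on U J" "inj_on V J"
    and UV: "\<And>j. j \<in> J \<Longrightarrow> finite (V j)" "\<And>j. j \<in> J \<Longrightarrow> U j \<subseteq> V j"
      "\<And>j. j \<in> J \<Longrightarrow> card (U j) = i" "\<And>j. j \<in> J \<Longrightarrow> Suc i < card (V j)"
  shows "card J \<le> card (\<Union>j\<in>J. {Z. U j \<subseteq> Z \<and> Z \<subseteq> V j \<and> card Z = Suc i})"
proof -
  define N where "N j = {Z. U j \<subseteq> Z \<and> Z \<subseteq> V j \<and> card Z = Suc i}" for j
  have finN: "finite (N j)" if "j \<in> J" for j
    using UV(1)[OF that] by (auto simp: N_def intro: finite_subset[of _ "Pow (V j)"])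
  have finU: "finite (U j)" if "j \<in> J" for j
    using UV(1,2)[OF that] finite_subset by blast
  have star: "(\<lambda>v. insert v (U j)) ` (V j - U j) \<subseteq> N j" if "j \<in> J" for j
    using UV(2,3)[OF that] finU[OF that] by (auto simp: N_def)
  have two: "2 \<le> card (N j)" if j: "j \<in> J" for j
  proof -
    have "inj_on (\<lambda>v. insert v (U j)) (V j - U j)"
      by (auto simp: inj_on_def)
    then have "card (V j - U j) \<le> card (N j)"
      using star[OF j] finN[OF j] by (rule card_inj_on_le)
    moreover have "card (V j - U j) = card (V j) - i"
      using UV[OF j] finU[OF j] by (simp add: card_Diff_subset)
    ultimately show ?thesis
      using UV(4)[OF j] by linarith
  qed
  \<comment> \<open>The layer determines its upper end: single points of \<open>V j - U j\<close>
    added to \<open>U j\<close> already exhaust \<open>V j\<close>.\<close>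
  have Union_N: "\<Union> (N j) = V j" if j: "j \<in> J" for j
  proof -
    have "V j - U j \<noteq> {}"
      using UV[OF j] by (metis Diff_eq_empty_iff Suc_n_not_le_n Suc_leD less_imp_le_nat subset_antisym)
    then have "V j \<subseteq> \<Union> ((\<lambda>v. insert v (U j)) ` (V j - U j))"
      by auto
    also have "\<dots> \<subseteq> \<Union> (N j)"
      by (intro Union_mono star j)
    finally show ?thesis
      by (auto simp: N_def)
  qed
  \<comment> \<open>Distinct sets of size \<open>i\<close> have a union of at least
    \<open>Suc i\<close> elements, so a common member of both layers, being of size
    \<open>Suc i\<close>, equals this union.\<close>
  have meet: "Z = U j \<union> U k" if jk: "j \<in> J" "k \<in> J" "j \<noteq> k" and Z: "Z \<in> N j" "Z \<in> N k" for j k Z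
  proof -
    have finZ: "finite Z"
      using Z(1) UV(1)[OF jk(1)] finite_subset unfolding N_def by blast
    have "U j \<noteq> U k"
      using inj(1) jk by (auto simp: inj_on_def)
    then have "U j \<subset> U j \<union> U k"
      using card_subset_eq[OF finU[OF jk(1)], of "U k"] UV(3) jk by auto
    then have "i < card (U j \<union> U k)"
      using psubset_card_mono[of "U j \<union> U k" "U j"] finU UV(3) jk by simp
    then show ?thesis
      using Z finZ by (intro card_seteq[symmetric]) (auto simp: N_def)
  qed
  have "card J \<le> card (\<Union> (N ` J))"
  proof (rule card_le_card_Union_of_linear[OF J finN two])
    show "card (N j \<inter> N k) \<le> 1" if "j \<in> J" "k \<in> J" "j \<noteq> k" for j k
    proof -
      have "N j \<inter> N k \<subseteq> {U j \<union> U k}"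
        using meet[OF that] by blast
      then show ?thesis
        using card_mono[of "{U j \<union> U k}"] by simp
    qed
    show False if J: "{j, k, l} \<subseteq> J" and N: "N j = {p, q}" "N k = {q, r}" "N l = {p, r}"
      and ne: "p \<noteq> q" "q \<noteq> r" "p \<noteq> r" for j k l p q r
    proof -
      have jkl: "j \<noteq> k" "k \<noteq> l" "j \<noteq> l"
        using N ne by auto
      have "q = U j \<union> U k" "r = U k \<union> U l" "p = U j \<union> U l"
        using meet jkl J N by auto
      moreover have "V j = p \<union> q" "V k = q \<union> r"
        using Union_N[of j] Union_N[of k] J N by auto
      ultimately have "V j = V k" by auto
      with inj(2) J jkl(1) show False
        by (auto simp: inj_on_def)
    qed
  qed
  then show ?thesis
    by (simp add: N_def)
qed

lemma comparable_card_le_imp_subset: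
  assumes "X \<subseteq> Y \<or> Y \<subseteq> X" "finite X" "card X \<le> card Y"
  shows "X \<subseteq> Y"
proof (cases "X \<subseteq> Y")
  case False
  with assms have "Y = X"
    by (intro card_seteq) auto
  then show ?thesis by simp
qed

lemma pairwise_incomparable_level:
  assumes "\<forall>X\<in>F. finite X"
  shows "pairwise incomparable (level F i)"
proof (rule pairwiseI)
  fix X Y assume "X \<in> level F i" "Y \<in> level F i" "X \<noteq> Y"
  then show "incomparable X Y"
    using assms card_subset_eq[of X Y] card_subset_eq[of Y X]
    by (auto simp: incomparable_def level_def)
qed

lemma saturated_finite:
  assumes "antichain_saturated n k F"
  shows "finite F" "\<forall>X\<in>F. finite X"
proof -
  have sub: "F \<subseteq> Pow {1..n}"
    using assms unfolding antichain_saturated_def by blast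
  then show "finite F"
    by (rule finite_subset) simp
  show "\<forall>X\<in>F. finite X"
    using sub finite_subset by blast
qed

lemma saturated_level_card_le:
  assumes "antichain_saturated n (Suc k) F"
  shows "card (level F i) \<le> k"
proof (rule ccontr)
  assume "\<not> card (level F i) \<le> k"
  then have "contains_antichain (Suc k) F"
    using pairwise_incomparable_level[OF saturated_finite(2)[OF assms]]
    by (intro antichain_of_card_ge[of "level F i"]) (auto simp: level_def)
  with assms show False
    unfolding antichain_saturated_def by blast
qed

text \<open>Chain colourings certify membership: if \<open>F\<close> together with \<open>G\<close>
  is still a union of \<open>k\<close> chains, then no member of \<open>G\<close> can complete an
  antichain of size \<open>Suc k\<close>, so none is missing from \<open>F\<close>.\<close>

lemma saturated_absorbs:
  assumes "antichain_saturated n (Suc k) F" "chain_colouring k c (F \<union> G)" "G \<subseteq> Pow {1..n}"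
  shows "G \<subseteq> F"
proof (rule ccontr)
  assume "\<not> G \<subseteq> F"
  then obtain X where X: "X \<in> G" "X \<notin> F" by blast
  then have "contains_antichain (Suc k) (insert X F)"
    using assms unfolding antichain_saturated_def by blast
  then have "contains_antichain (Suc k) (F \<union> G)"
    by (rule contains_antichain_mono) (use X in auto)
  with chain_colouring_imp_no_antichain[OF assms(2)] show False ..
qed

lemma saturated_level_full_step:
  assumes sat: "antichain_saturated n 6 F" and i: "5 \<le> card (level F i)"
    and b: "5 \<le> card (level F b)" "Suc i < b"
  shows "5 \<le> card (level F (Suc i))"
proof -
  note fin = saturated_finite[OF sat]
  have "\<not> contains_antichain (Suc 5) F"
    using sat unfolding antichain_saturated_def by simp
  then obtain c where c: "chain_colouring 5 c F"
    using dilworth_chain_colouring fin by blast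
  \<comment> \<open>A full level is a maximum antichain, so each of the five chains passes through
    it.\<close>
  have full: "\<exists>X. X \<in> F \<and> card X = m \<and> c X = j" if m: "5 \<le> card (level F m)" and j: "j < 5" for m j
  proof -
    have sub: "level F m \<subseteq> F"
      by (auto simp: level_def)
    note anti = pairwise_incomparable_level[OF fin(2), of m]
    have "card (level F m) = 5"
      using antichain_card_le[OF c sub anti] m by simp
    then have "j \<in> c ` level F m"
      using maximum_antichain_colours[OF c sub anti] j by simp
    then show ?thesis
      by (auto simp: level_def)
  qed
  have comparable: "X \<subseteq> Y" if "X \<in> F" "Y \<in> F" "c X = c Y" "card X \<le> card Y" for X Y
    using that c fin(2) by (intro comparable_card_le_imp_subset) (auto simp: chain_colouring_def)
  have "\<forall>j\<in>{..<5}. \<exists>X. X \<in> F \<and> card X = i \<and> c X = j"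
    using full[OF i] by blast
  then obtain U where U: "\<And>j. j < 5 \<Longrightarrow> U j \<in> F \<and> card (U j) = i \<and> c (U j) = j"
    by (metis lessThan_iff)
  \<comment> \<open>\<open>V j\<close> will be the first member of chain \<open>j\<close> strictly
    beyond level \<open>Suc i\<close>; level \<open>b\<close> guarantees one. A member on level
    \<open>Suc i\<close> itself is skipped, so that the layer between \<open>U j\<close> and
    \<open>V j\<close> has at least two sets.\<close>
  have "\<exists>X. (X \<in> F \<and> Suc i < card X \<and> c X = j) \<and>
      (\<forall>Y. Y \<in> F \<and> Suc i < card Y \<and> c Y = j \<longrightarrow> card X \<le> card Y)" if j: "j < 5" for j
  proof -
    obtain W where "W \<in> F \<and> Suc i < card W \<and> c W = j"
      using full[OF b(1) j] b(2) by blast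
    then show ?thesis
      by (rule ex_has_least_nat)
  qed
  then obtain V where V: "\<And>j. j < 5 \<Longrightarrow> V j \<in> F \<and> Suc i < card (V j) \<and> c (V j) = j"
    and V_least: "\<And>j Y. j < 5 \<Longrightarrow> Y \<in> F \<Longrightarrow> Suc i < card Y \<Longrightarrow> c Y = j \<Longrightarrow> card (V j) \<le> card Y"
    by metis
  have below: "Y \<subseteq> U (c Y)" if "Y \<in> F" "card Y \<le> i" for Y
    using U[of "c Y"] that c by (intro comparable) (auto simp: chain_colouring_def)
  have above_U: "U (c Y) \<subseteq> Y" if "Y \<in> F" "i \<le> card Y" for Y
    using U[of "c Y"] that c by (intro comparable) (auto simp: chain_colouring_def)
  have above: "V (c Y) \<subseteq> Y" if "Y \<in> F" "Suc i < card Y" for Y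
    using V[of "c Y"] V_least[of "c Y" Y] that c by (intro comparable) (auto simp: chain_colouring_def)
  have below_V: "Y \<subseteq> V (c Y)" if "Y \<in> F" "card Y \<le> Suc i" for Y
    using V[of "c Y"] that c by (intro comparable) (auto simp: chain_colouring_def)
  define N where "N j = {Z. U j \<subseteq> Z \<and> Z \<subseteq> V j \<and> card Z = Suc i}" for j
  have finV: "finite (V j)" if "j < 5" for j
    using V[OF that] fin(2) by blast
  have UV: "U j \<subseteq> V j" if "j < 5" for j
    using below_V[of "U j"] U[OF that] by simp
  have "\<exists>h. inj_on h {..<5} \<and> (\<forall>j\<in>{..<5}. h j \<in> N j)"
  proof (rule hall_transversal)
    show "finite (N j)" if "j \<in> {..<5}" for j
      using finV[of j] that by (auto simp: N_def intro: finite_subset[of _ "Pow (V j)"])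
    show "card I \<le> card (\<Union> (N ` I))" if I: "I \<subseteq> {..<5}" for I
      unfolding N_def
    proof (rule card_le_card_intermediate_layer)
      show "finite I"
        using I finite_subset by blast
      show "card I \<le> 5"
        using card_mono[OF _ I] by simp
      show "inj_on U I"
        by (rule inj_on_inverseI[of _ c]) (use U I in auto)
      show "inj_on V I"
        by (rule inj_on_inverseI[of _ c]) (use V I in auto)
      fix j assume "j \<in> I"
      then have j: "j < 5"
        using I by blast
      show "finite (V j)" "U j \<subseteq> V j" "card (U j) = i" "Suc i < card (V j)"
        using finV[OF j] UV[OF j] U[OF j] V[OF j] by simp_all
    qed
  qed simp
  then obtain h0 where h0: "inj_on h0 {..<5}" "\<forall>j\<in>{..<5}. h0 j \<in> N j" by blast
  \<comment> \<open>The members of \<open>F\<close> on level \<open>Suc i\<close> have to be among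
    the chosen sets, since five chains allow at most five sets there. Each such \<open>z\<close>
    lies in the layer of its own chain, so \<open>c\<close> matches them to indices.\<close>
  have "\<exists>h. inj_on h {..<5} \<and> (\<forall>j\<in>{..<5}. h j \<in> N j) \<and> level F (Suc i) \<subseteq> h ` {..<5}"
  proof (rule transversal_covering[OF _ h0])
    show "inj_on c (level F (Suc i))"
      by (rule inj_on_chain_colouring[OF c _ pairwise_incomparable_level[OF fin(2)]])
        (auto simp: level_def)
    show "c ` level F (Suc i) \<subseteq> {..<5}"
      using c by (auto simp: level_def chain_colouring_def)
    show "\<forall>z\<in>level F (Suc i). z \<in> N (c z)"
      using above_U below_V by (auto simp: level_def N_def)
  qed simp
  then obtain h where h: "inj_on h {..<5}" "\<forall>j\<in>{..<5}. h j \<in> N j" "level F (Suc i) \<subseteq> h ` {..<5}"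
    by blast
  define G where "G = h ` {..<5}"
  have cardG: "card X = Suc i" if "X \<in> G" for X
    using that h(2) by (auto simp: G_def N_def)
  \<comment> \<open>On level \<open>Suc i\<close> the old colours are replaced by the indices of
    \<open>h\<close>, which may differ from them; all other levels keep \<open>c\<close>.\<close>
  define c' where "c' X = (if card X = Suc i then inv_into {..<5} h X else c X)" for X
  have c'h: "c' (h j) = j" if "j < 5" for j
    using that h(1,2) by (auto simp: c'_def N_def)
  have cover: "X \<in> G \<or> X \<in> F \<and> card X \<noteq> Suc i \<and> c' X = c X" if "X \<in> F \<union> G" for X
    using that h(3) by (auto simp: c'_def G_def level_def)
  \<comment> \<open>Chain \<open>j\<close> is rerouted through \<open>h j\<close>: its members of
    size at most \<open>i\<close> lie below \<open>U j\<close>, those beyond \<open>Suc i\<close>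
    above \<open>V j\<close>.\<close>
  have mixed: "X \<subseteq> Y \<or> Y \<subseteq> X"
    if X: "X \<in> G" and Y: "Y \<in> F" "card Y \<noteq> Suc i" "c' Y = c Y" and eq: "c' X = c' Y" for X Y
  proof -
    obtain j where j: "j < 5" "X = h j"
      using X by (auto simp: G_def)
    then have cY: "c Y = j"
      using c'h eq Y(3) by simp
    have "U j \<subseteq> X" "X \<subseteq> V j"
      using h(2) j by (auto simp: N_def)
    then show ?thesis
      using below[OF Y(1)] above[OF Y(1)] Y(2) cY by (cases "card Y \<le> i") auto
  qed
  have "chain_colouring 5 c' (F \<union> G)"
    unfolding chain_colouring_def
  proof (intro conjI ballI impI)
    fix X assume "X \<in> F \<union> G"
    from cover[OF this] show "c' X < 5"
      using c c'h by (auto simp: chain_colouring_def G_def)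
  next
    fix X Y assume XY: "X \<in> F \<union> G" "Y \<in> F \<union> G" "c' X = c' Y"
    consider "X \<in> G" "Y \<in> G" | "X \<in> G" "Y \<in> F" "card Y \<noteq> Suc i" "c' Y = c Y"
      | "Y \<in> G" "X \<in> F" "card X \<noteq> Suc i" "c' X = c X"
      | "X \<in> F" "Y \<in> F" "c' X = c X" "c' Y = c Y"
      using cover[OF XY(1)] cover[OF XY(2)] by blast
    then show "X \<subseteq> Y \<or> Y \<subseteq> X"
    proof cases
      case 1
      then show ?thesis using c'h XY(3) by (auto simp: G_def)
    next
      case 2
      then show ?thesis using mixed XY(3) by blast
    next
      case 3
      then show ?thesis using mixed[of Y X] XY(3) by auto
    next
      case 4
      then show ?thesis using c XY(3) by (auto simp: chain_colouring_def)
    qed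
  qed
  moreover have "G \<subseteq> Pow {1..n}"
  proof
    fix X assume "X \<in> G"
    then obtain j where "j < 5" "X \<subseteq> V j"
      using h(2) by (auto simp: G_def N_def)
    then show "X \<in> Pow {1..n}"
      using V[of j] sat unfolding antichain_saturated_def by blast
  qed
  moreover have "antichain_saturated n (Suc 5) F"
    using sat by simp
  ultimately have "G \<subseteq> F"
    using saturated_absorbs by blast
  then have "G \<subseteq> level F (Suc i)"
    using cardG by (auto simp: level_def)
  then have "card G \<le> card (level F (Suc i))"
    using fin(1) by (intro card_mono) (auto simp: level_def)
  moreover have "card G = 5"
    using h(1) by (simp add: G_def card_image)
  ultimately show ?thesis by simp
qed

lemma saturated_level_full_between:
  assumes "antichain_saturated n 6 F" "5 \<le> card (level F a)" "5 \<le> card (level F b)" "a \<le> i" "i \<le> b"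
  shows "5 \<le> card (level F i)"
  using assms(4,5)
proof (induction i rule: dec_induct)
  case base
  show ?case by (rule assms(2))
next
  case (step i)
  show ?case
  proof (cases "Suc i = b")
    case True
    then show ?thesis using assms(3) by simp
  next
    case False
    then show ?thesis
      using step saturated_level_full_step[OF assms(1) _ assms(3)] by simp
  qed
qed

text \<open>An antichain of size \<open>Suc k\<close> in \<open>insert X F\<close> leaves
  \<open>k\<close> sets in \<open>F\<close> after removal of \<open>X\<close>. So without
  \<open>k\<close> incomparable sets, \<open>F\<close> would be the whole powerset of
  \<open>{1..n}\<close>, whose \<open>n\<close> singletons already form too large an
  antichain.\<close>

lemma saturated_contains_antichain:
  assumes sat: "antichain_saturated n (Suc k) F" and "Suc k \<le> n"
  shows "contains_antichain k F"
proof (rule ccontr)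
  assume no: "\<not> contains_antichain k F"
  have "X \<in> F" if X: "X \<subseteq> {1..n}" for X
  proof (rule ccontr)
    assume "X \<notin> F"
    then have "contains_antichain (Suc k) (insert X F)"
      using sat X unfolding antichain_saturated_def by blast
    then obtain C where C: "C \<subseteq> insert X F" "finite C" "card C = Suc k" "pairwise incomparable C"
      unfolding contains_antichain_def by blast
    have "k \<le> card (C - {X})"
      using C(2,3) by (simp add: card_Diff_singleton_if)
    moreover have "pairwise incomparable (C - {X})"
      using C(4) by (rule pairwise_subset) auto
    ultimately have "contains_antichain k F"
      using C(1) by (intro antichain_of_card_ge[of "C - {X}"]) auto
    with no show False ..
  qed
  then have "(\<lambda>x. {x}) ` {1..n} \<subseteq> F" by auto
  moreover have "card ((\<lambda>x. {x}) ` {1..n}) = n"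
    by (subst card_image) auto
  moreover have "pairwise incomparable ((\<lambda>x. {x}) ` {1..n})"
    by (auto simp: pairwise_def incomparable_def)
  ultimately have "contains_antichain (Suc k) F"
    using assms(2) antichain_of_card_ge by metis
  with sat show False
    unfolding antichain_saturated_def by blast
qed

section \<open>Lowest and highest levels\<close>

definition complements :: "nat \<Rightarrow> nat set set \<Rightarrow> nat set set" where
  "complements n F = (\<lambda>X. {1..n} - X) ` F"

lemma inj_on_complement: "inj_on (\<lambda>X. A - X) (Pow A)"
  by (auto simp: inj_on_def)

lemma complements_subset: "complements n F \<subseteq> Pow {1..n}"
  by (auto simp: complements_def)

lemma complements_complements: "F \<subseteq> Pow {1..n} \<Longrightarrow> complements n (complements n F) = F"
  by (auto simp: complements_def image_image double_diff)

lemma card_complements: "F \<subseteq> Pow {1..n} \<Longrightarrow> card (complements n F) = card F"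
  unfolding complements_def by (rule card_image) (rule inj_on_subset[OF inj_on_complement])

lemma pairwise_incomparable_complements:
  assumes "F \<subseteq> Pow {1..n}" "pairwise incomparable F"
  shows "pairwise incomparable (complements n F)"
  unfolding complements_def
proof (rule pairwiseI; clarify)
  fix X Y assume "X \<in> F" "Y \<in> F" "{1..n} - X \<noteq> {1..n} - Y"
  then have "incomparable X Y" "X \<subseteq> {1..n}" "Y \<subseteq> {1..n}"
    using assms unfolding pairwise_def by auto
  then show "incomparable ({1..n} - X) ({1..n} - Y)"
    unfolding incomparable_def by blast
qed

lemma contains_antichain_complements:
  assumes F: "F \<subseteq> Pow {1..n}" and "contains_antichain k F"
  shows "contains_antichain k (complements n F)"
proof -
  obtain C where C: "C \<subseteq> F" "card C = k" "pairwise incomparable C"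
    using assms(2) unfolding contains_antichain_def by blast
  then have "C \<subseteq> Pow {1..n}"
    using F by blast
  moreover have "complements n C \<subseteq> complements n F"
    using C(1) by (auto simp: complements_def)
  ultimately show ?thesis
    using C antichain_of_card_ge[of "complements n C"] card_complements
      pairwise_incomparable_complements by simp
qed

lemma antichain_saturated_complements:
  assumes sat: "antichain_saturated n k F"
  shows "antichain_saturated n k (complements n F)"
  unfolding antichain_saturated_def
proof (intro conjI allI impI)
  have F: "F \<subseteq> Pow {1..n}" and no: "\<not> contains_antichain k F"
    using sat unfolding antichain_saturated_def by blast+
  show "complements n F \<subseteq> Pow {1..n}"
    by (rule complements_subset)
  show "\<not> contains_antichain k (complements n F)"
    using no contains_antichain_complements[OF complements_subset] complements_complements[OF F] by metis
  fix X assume X: "X \<subseteq> {1..n} \<and> X \<notin> complements n F"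
  then have XX: "{1..n} - ({1..n} - X) = X"
    by blast
  then have eq: "complements n (insert ({1..n} - X) F) = insert X (complements n F)"
    unfolding complements_def by (simp only: image_insert)
  have "{1..n} - X \<notin> F"
    using X XX unfolding complements_def by (metis imageI)
  then have "contains_antichain k (insert ({1..n} - X) F)"
    using sat unfolding antichain_saturated_def by blast
  then show "contains_antichain k (insert X (complements n F))"
    using contains_antichain_complements[of "insert ({1..n} - X) F" n] F eq by auto
qed

lemma card_level_complements:
  assumes F: "F \<subseteq> Pow {1..n}" and i: "i \<le> n"
  shows "card (level (complements n F) i) = card (level F (n - i))"
proof -
  have card: "card ({1..n} - X) = n - card X" "card X \<le> n" if "X \<in> F" for X
    using F that card_mono[of "{1..n}" X] by (auto simp: card_Diff_subset finite_subset)
  have "level (complements n F) i = complements n (level F (n - i))"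
    using i card by (force simp: level_def complements_def)
  moreover have "level F (n - i) \<subseteq> Pow {1..n}"
    using F by (auto simp: level_def)
  ultimately show ?thesis
    by (simp add: card_complements)
qed

section \<open>Top and bottom maximum antichains\<close>

text \<open>\<open>A\<close> is the top antichain. If a set \<open>X\<close> above
  \<open>A i\<close> were missing, then an antichain of size \<open>Suc k\<close> in
  \<open>insert X F\<close> would consist of \<open>X\<close> and a \<open>k\<close>-element
  antichain of \<open>F\<close>, whose member of colour \<open>i\<close> lies below
  \<open>A i\<close> and hence below \<open>X\<close>.\<close>

lemma saturated_up_closed_antichain:
  assumes sat: "antichain_saturated n (Suc k) F" and n: "Suc k \<le> n"
  obtains A where "A \<subseteq> F" "pairwise incomparable A" "card A = k"
    "\<And>a X. a \<in> A \<Longrightarrow> a \<subseteq> X \<Longrightarrow> X \<subseteq> {1..n} \<Longrightarrow> X \<in> F"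
proof -
  note fin = saturated_finite[OF sat]
  have "\<not> contains_antichain (Suc k) F"
    using sat unfolding antichain_saturated_def by blast
  then obtain c where c: "chain_colouring k c F"
    using dilworth_chain_colouring fin by blast
  obtain A where A: "\<And>i. i < k \<Longrightarrow> A i \<in> F" "\<And>i. i < k \<Longrightarrow> c (A i) = i"
    "\<And>i j. i < k \<Longrightarrow> j < k \<Longrightarrow> i \<noteq> j \<Longrightarrow> incomparable (A i) (A j)"
    "\<And>B b. B \<subseteq> F \<Longrightarrow> pairwise incomparable B \<Longrightarrow> card B = k \<Longrightarrow> b \<in> B \<Longrightarrow> b \<subseteq> A (c b)"
    using ex_top_antichain[OF fin c saturated_contains_antichain[OF sat n]] by blast
  show thesis
  proof
    show "A ` {..<k} \<subseteq> F"
      using A(1) by blast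
    show "pairwise incomparable (A ` {..<k})"
      by (auto simp: pairwise_def intro!: A(3))
    have "inj_on A {..<k}"
      by (rule inj_on_inverseI[of _ c]) (simp add: A(2))
    then show "card (A ` {..<k}) = k"
      by (simp add: card_image)
    show "X \<in> F" if a: "a \<in> A ` {..<k}" and X: "a \<subseteq> X" "X \<subseteq> {1..n}" for a X
    proof (rule ccontr)
      obtain i where i: "i < k" "a = A i"
        using a by blast
      assume "X \<notin> F"
      then have "contains_antichain (Suc k) (insert X F)"
        using sat X(2) unfolding antichain_saturated_def by blast
      then obtain C where C: "C \<subseteq> insert X F" "finite C" "card C = Suc k" "pairwise incomparable C"
        unfolding contains_antichain_def by blast
      have "X \<in> C"
      proof (rule ccontr)
        assume "X \<notin> C"
        then have "C \<subseteq> F"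
          using C(1) by blast
        then show False
          using antichain_card_le[OF c _ C(4)] C(3) by simp
      qed
      define B where "B = C - {X}"
      have B: "B \<subseteq> F" "pairwise incomparable B" "card B = k"
        using C \<open>X \<in> C\<close> by (auto simp: B_def pairwise_def)
      have "i \<in> c ` B"
        using maximum_antichain_colours[OF c B] i(1) by simp
      then obtain b where b: "b \<in> B" "c b = i" by blast
      have "b \<subseteq> X"
        using A(4)[OF B b(1)] b(2) i(2) X(1) by blast
      moreover have "b \<in> C" "b \<noteq> X"
        using b(1) by (auto simp: B_def)
      ultimately show False
        using C(4) \<open>X \<in> C\<close> unfolding pairwise_def incomparable_def by blast
    qed
  qed
qed

text \<open>Complementation turns the top antichain of the complementary family, which is again
  saturated, into a bottom antichain of \<open>F\<close>.\<close>

lemma saturated_down_closed_antichain: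
  assumes sat: "antichain_saturated n (Suc k) F" and n: "Suc k \<le> n"
  obtains A where "A \<subseteq> F" "pairwise incomparable A" "card A = k"
    "\<And>a X. a \<in> A \<Longrightarrow> X \<subseteq> a \<Longrightarrow> X \<in> F"
proof -
  have F: "F \<subseteq> Pow {1..n}"
    using sat unfolding antichain_saturated_def by blast
  obtain A where A: "A \<subseteq> complements n F" "pairwise incomparable A" "card A = k"
    "\<And>a X. a \<in> A \<Longrightarrow> a \<subseteq> X \<Longrightarrow> X \<subseteq> {1..n} \<Longrightarrow> X \<in> complements n F"
    using saturated_up_closed_antichain[OF antichain_saturated_complements[OF sat] n] by blast
  have AP: "A \<subseteq> Pow {1..n}"
    using A(1) complements_subset by blast
  show thesis
  proof
    have "complements n A \<subseteq> complements n (complements n F)"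
      using A(1) unfolding complements_def by (rule image_mono)
    then show "complements n A \<subseteq> F"
      by (simp add: complements_complements[OF F])
    show "pairwise incomparable (complements n A)"
      using AP A(2) by (rule pairwise_incomparable_complements)
    show "card (complements n A) = k"
      using AP A(3) by (simp add: card_complements)
    fix a X assume "a \<in> complements n A" "X \<subseteq> a"
    then obtain b where b: "b \<in> A" "X \<subseteq> {1..n} - b"
      by (auto simp: complements_def)
    then have X: "X \<subseteq> {1..n}" and "b \<subseteq> {1..n} - X"
      using AP by blast+
    then have "{1..n} - X \<in> complements n F"
      using A(4) b(1) by blast
    then obtain Y where "Y \<in> F" "{1..n} - X = {1..n} - Y"
      unfolding complements_def by blast
    then show "X \<in> F"
      using F X by (metis Pow_iff double_diff order_refl subsetD)
  qed
qed

section \<open>Antichains of subsets of at most four points\<close>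

lemma antichain_card_le_three:
  assumes "finite S" "card S \<le> 3" "C \<subseteq> Pow S" "pairwise incomparable C"
  shows "card C \<le> 3"
proof -
  have "card S \<in> {0, 1, 2, 3}"
    using assms(2) by auto
  then have "\<exists>x y z. S \<subseteq> {x, y, z}"
    using assms(1) by (auto simp: card_1_singleton_iff card_2_iff card_3_iff)
  then obtain x y z where S: "S \<subseteq> {x, y, z}" by blast
  \<comment> \<open>For distinct points this gives the chains \<open>{}\<close>, \<open>{x}\<close>,
    \<open>{x, y}\<close>, \<open>{x, y, z}\<close> of colour 0, \<open>{y}\<close>,
    \<open>{y, z}\<close> of colour 1, and \<open>{z}\<close>, \<open>{x, z}\<close> of colour
    2.\<close>
  define c :: "'a set \<Rightarrow> nat" where
    "c X = (if (y \<in> X \<longrightarrow> x \<in> X) \<and> (z \<in> X \<longrightarrow> y \<in> X) then 0 else if y \<in> X then 1 else 2)" for X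
  have "chain_colouring 3 c (Pow {x, y, z})"
    unfolding chain_colouring_def c_def by (auto split: if_splits)
  then show ?thesis
    using assms(3,4) S by (intro antichain_card_le[of 3 c "Pow {x, y, z}"]) auto
qed

text \<open>The empty set and \<open>S\<close> are comparable to everything. Beside a singleton
  \<open>{x}\<close>, the other four sets would lie in \<open>S - {x}\<close>; beside a
  three-element set they would all contain the remaining point, and their traces would form an
  antichain. Either way a three-element set would have four incomparable subsets.\<close>

lemma antichain_of_four_pairs:
  assumes S: "finite S" "card S = 4" and A: "A \<subseteq> Pow S" "pairwise incomparable A" "card A = 5"
    and X: "X \<in> A"
  shows "card X = 2"
proof -
  have finA: "finite A"
    using A(3) by (simp add: card_ge_0_finite)
  have rest: "card (A - {X}) = 4"
    using A(3) X finA by simp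
  have inc: "\<not> X \<subseteq> Y" "\<not> Y \<subseteq> X" if "Y \<in> A - {X}" for Y
    using A(2) X that unfolding pairwise_def incomparable_def by blast+
  have antirest: "pairwise incomparable (A - {X})"
    using A(2) by (rule pairwise_subset) auto
  have "A - {X} \<noteq> {}"
    using rest by (metis card.empty zero_neq_numeral)
  then obtain Y where Y: "Y \<in> A - {X}" by blast
  have XS: "X \<subseteq> S" "finite X"
    using A(1) X S(1) finite_subset by blast+
  have "X \<noteq> {}" "X \<noteq> S"
    using inc[OF Y] Y A(1) by blast+
  then have "card X \<noteq> 0" "card X < 4"
    using XS S psubset_card_mono[of S X] by auto
  moreover have "card X \<noteq> 1"
  proof
    assume "card X = 1"
    then obtain x where x: "X = {x}"
      using card_1_singletonE by blast
    have "A - {X} \<subseteq> Pow (S - {x})"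
      using A(1) inc x by blast
    then have "card (A - {X}) \<le> 3"
      using S XS x antirest by (intro antichain_card_le_three[of "S - {x}"]) auto
    with rest show False by simp
  qed
  moreover have "card X \<noteq> 3"
  proof
    assume X3: "card X = 3"
    then have "card (S - X) = 1"
      using S XS by (simp add: card_Diff_subset)
    then obtain d where d: "S - X = {d}"
      using card_1_singletonE by blast
    then have "S \<subseteq> insert d X" by blast
    then have split: "Y = insert d (Y \<inter> X)" if "Y \<in> A - {X}" for Y
      using inc(2)[OF that] that A(1) by blast
    then have "inj_on (\<lambda>Y. Y \<inter> X) (A - {X})"
      by (metis (no_types, lifting) inj_onI)
    then have "card ((\<lambda>Y. Y \<inter> X) ` (A - {X})) = 4"
      using rest by (simp add: card_image)
    moreover have "incomparable (Y \<inter> X) (Z \<inter> X)"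
      if "Y \<in> A - {X}" "Z \<in> A - {X}" "Y \<noteq> Z" for Y Z
    proof -
      have "incomparable Y Z"
        using antirest that unfolding pairwise_def by blast
      then show ?thesis
        using split[OF that(1)] split[OF that(2)] unfolding incomparable_def by blast
    qed
    then have "pairwise incomparable ((\<lambda>Y. Y \<inter> X) ` (A - {X}))"
      unfolding pairwise_def by blast
    then have "card ((\<lambda>Y. Y \<inter> X) ` (A - {X})) \<le> 3"
      using XS X3 by (intro antichain_card_le_three[of X]) auto
    ultimately show False by simp
  qed
  ultimately show ?thesis by linarith
qed

lemma saturated_bottom_levels:
  assumes sat: "antichain_saturated n 6 F" and n: "6 \<le> n"
  shows "1 \<le> card (level F 0)" "4 \<le> card (level F 1)"
    "5 \<le> card (level F 1) \<or> 5 \<le> card (level F 2)"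
proof -
  note fin = saturated_finite[OF sat]
  have fin_level: "finite (level F i)" for i
    using fin(1) by (simp add: level_def)
  have "antichain_saturated n (Suc 5) F" "Suc 5 \<le> n"
    using assms by auto
  then obtain A where A: "A \<subseteq> F" "pairwise incomparable A" "card A = 5"
    and down: "\<And>a X. a \<in> A \<Longrightarrow> X \<subseteq> a \<Longrightarrow> X \<in> F"
    using saturated_down_closed_antichain by metis
  obtain a where a: "a \<in> A"
    using A(3) by fastforce
  then have "{} \<in> level F 0"
    using down by (auto simp: level_def)
  then show "1 \<le> card (level F 0)"
    using fin_level[of 0] by (metis One_nat_def Suc_leI card_gt_0_iff empty_iff)
  define S where "S = {x. {x} \<in> F}"
  have S_level: "(\<lambda>x. {x}) ` S = level F 1"
    by (auto simp: S_def level_def card_1_singleton_iff)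
  have cardS: "card S = card (level F 1)"
    by (subst S_level[symmetric]) (simp add: card_image)
  have finS: "finite S"
    using fin_level[of 1] S_level by (metis finite_imageD inj_on_def singleton_inject)
  \<comment> \<open>All singletons below a member of \<open>A\<close> belong to \<open>F\<close>, so
    the five sets of \<open>A\<close> are subsets of \<open>S\<close>, which therefore has at least
    four points.\<close>
  have AS: "A \<subseteq> Pow S"
    using down by (auto simp: S_def)
  show S4: "4 \<le> card (level F 1)"
    using antichain_card_le_three[OF finS _ AS A(2)] A(3) cardS by linarith
  show "5 \<le> card (level F 1) \<or> 5 \<le> card (level F 2)"
  proof (cases "card S = 4")
    case True
    then have "A \<subseteq> level F 2"
      using antichain_of_four_pairs[OF finS True AS A(2,3)] A(1) by (auto simp: level_def)
    then have "5 \<le> card (level F 2)"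
      using card_mono[OF fin_level, of A 2] A(3) by simp
    then show ?thesis ..
  next
    case False
    then show ?thesis
      using S4 cardS by linarith
  qed
qed

section \<open>The saturation number\<close>

text \<open>Level sizes of an extremal family for \<open>n \<ge> 6\<close>: a termwise lower bound
  for every saturated family and a termwise upper bound for the constructed one.\<close>

definition profile :: "nat \<Rightarrow> nat \<Rightarrow> nat" where
  "profile n i = (if i = 0 \<or> i = n then 1 else if i = 1 \<or> i = n - 1 then 4 else 5)"

lemma sum_profile:
  assumes "n \<ge> 6"
  shows "(\<Sum>i\<le>n. profile n i) = 5 * n - 5"
proof -
  \<comment> \<open>Compared with the constant 5, the deficit is 4 at both ends and 1 next to each
    end, and 5(n + 1) - 10 = 5n - 5.\<close>
  have "(\<Sum>i\<le>n. 5) = (\<Sum>i\<le>n. profile n i + (if i = 0 then 4 else 0) + (if i = n then 4 else 0)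
      + (if i = 1 then 1 else 0) + (if i = n - 1 then 1 else 0))"
    using assms by (intro sum.cong) (auto simp: profile_def)
  also have "\<dots> = (\<Sum>i\<le>n. profile n i) + 10"
    using assms by (simp add: sum.distrib)
  finally show ?thesis by simp
qed

lemma card_eq_sum_levels:
  assumes "F \<subseteq> Pow {1..n}"
  shows "card F = (\<Sum>i\<le>n. card (level F i))"
proof -
  have fin: "finite F"
    using assms by (rule finite_subset) simp
  have "card X \<le> n" if "X \<in> F" for X
    using card_mono[of "{1..n}" X] assms that by auto
  then have "F = (\<Union>i\<le>n. level F i)"
    by (auto simp: level_def)
  then have "card F = card (\<Union>i\<le>n. level F i)"
    by simp
  also have "\<dots> = (\<Sum>i\<le>n. card (level F i))"
    using fin by (intro card_UN_disjoint) (auto simp: level_def)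
  finally show ?thesis .
qed

section \<open>The lower bound\<close>

lemma saturated_card_ge:
  assumes sat: "antichain_saturated n 6 F" and n: "6 \<le> n"
  shows "5 * n - 5 \<le> card F"
proof -
  have F: "F \<subseteq> Pow {1..n}"
    using sat unfolding antichain_saturated_def by blast
  note bottom = saturated_bottom_levels[OF sat n]
  \<comment> \<open>Levels 0, 1, 2 of the complementary family correspond to levels
    \<open>n\<close>, \<open>n - 1\<close>, \<open>n - 2\<close> of \<open>F\<close>.\<close>
  have top: "1 \<le> card (level F n)" "4 \<le> card (level F (n - 1))"
    "5 \<le> card (level F (n - 1)) \<or> 5 \<le> card (level F (n - 2))"
    using saturated_bottom_levels[OF antichain_saturated_complements[OF sat] n] n
    by (auto simp: card_level_complements[OF F])
  obtain a where a: "a \<le> 2" "5 \<le> card (level F a)"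
    using bottom(3) by (metis order_refl one_le_numeral)
  obtain b where b: "n - 2 \<le> b" "5 \<le> card (level F b)"
    using top(3) by (metis diff_le_mono2 order_refl one_le_numeral)
  have middle: "5 \<le> card (level F i)" if "2 \<le> i" "i \<le> n - 2" for i
    by (rule saturated_level_full_between[OF sat a(2) b(2)]) (use a(1) b(1) that in linarith)+
  have "profile n i \<le> card (level F i)" if i: "i \<le> n" for i
  proof -
    consider "i = 0" | "i = 1" | "2 \<le> i \<and> i \<le> n - 2" | "i = n - 1" | "i = n"
      using i by arith
    then show ?thesis
      using bottom(1,2) top(1,2) middle n by cases (auto simp: profile_def)
  qed
  then have "(\<Sum>i\<le>n. profile n i) \<le> (\<Sum>i\<le>n. card (level F i))"
    by (intro sum_mono) simp
  then show ?thesis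
    using sum_profile[OF n] card_eq_sum_levels[OF F] by simp
qed

section \<open>The upper bound\<close>

lemma ex_saturated_superset:
  assumes "F0 \<subseteq> Pow {1..n}" "\<not> contains_antichain k F0"
  obtains F where "F0 \<subseteq> F" "antichain_saturated n k F"
proof -
  define M where "M = {F. F0 \<subseteq> F \<and> F \<subseteq> Pow {1..n} \<and> \<not> contains_antichain k F}"
  have "finite M"
    by (rule finite_subset[of _ "Pow (Pow {1..n})"]) (auto simp: M_def)
  moreover have "F0 \<in> M"
    using assms by (simp add: M_def)
  ultimately obtain F where F: "F \<in> M" and max: "\<forall>G\<in>M. F \<subseteq> G \<longrightarrow> F = G"
    using finite_has_maximal[of M] by blast
  have "contains_antichain k (insert X F)" if X: "X \<subseteq> {1..n}" "X \<notin> F" for X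
  proof (rule ccontr)
    assume "\<not> contains_antichain k (insert X F)"
    with F X have "insert X F \<in> M"
      by (auto simp: M_def)
    with max have "F = insert X F"
      by blast
    with X show False
      by blast
  qed
  with F have "F0 \<subseteq> F" "antichain_saturated n k F"
    by (auto simp: M_def antichain_saturated_def)
  then show thesis
    by (rule that)
qed

text \<open>Five pairs \<open>p\<close> in \<open>{1..4}\<close> exclude all singletons \<open>{x}\<close> with \<open>x \<ge> 5\<close>, and the five sets
  \<open>p \<union> {5..n}\<close> exclude all sets \<open>{1..n} - {x}\<close> with \<open>x \<ge> 5\<close>. So every saturated family
  containing these ten sets is small enough.\<close>

lemma ex_saturated_card_le:
  assumes n: "6 \<le> n"
  obtains F where "antichain_saturated n 6 F" "card F \<le> 5 * n - 5"
proof -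
  have "card {e. e \<subseteq> {1..4::nat} \<and> card e = 2} = 6"
    by (simp add: n_subsets choose_two)
  then obtain P where P: "P \<subseteq> {e. e \<subseteq> {1..4::nat} \<and> card e = 2}" "card P = 5" "finite P"
    using obtain_subset_with_card_n[of 5 "{e. e \<subseteq> {1..4::nat} \<and> card e = 2}"] by auto
  define up where "up p = p \<union> {5..n}" for p :: "nat set"
  define Q where "Q = up ` P"
  have p4: "p \<subseteq> {1..4}" "finite p" "card p = 2" if "p \<in> P" for p
    using P(1) that finite_subset[of p "{1..4}"] by auto
  have trace: "p \<inter> {1..4} = p" "up p \<inter> {1..4} = p" if "p \<in> P" for p
    using p4(1)[OF that] by (auto simp: up_def)
  have card_up: "card (up p) = n - 2" if "p \<in> P" for p
  proof -
    have "p \<inter> {5..n} = {}"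
      using p4(1)[OF that] by auto
    then show ?thesis
      unfolding up_def using p4[OF that] n by (simp add: card_Un_disjoint)
  qed
  have "inj_on up P"
    using trace(2) by (rule inj_on_inverseI)
  then have cardQ: "card Q = 5"
    unfolding Q_def using P(2) by (simp add: card_image)
  obtain f where f: "bij_betw f P {0..<5::nat}"
    using ex_bij_betw_finite_nat[OF P(3)] P(2) by auto
  have sub: "P \<union> Q \<subseteq> Pow {1..n}"
    using p4(1) n by (fastforce simp: Q_def up_def)
  \<comment> \<open>The trace on \<open>{1..4}\<close> is \<open>p\<close> for both \<open>p\<close>
    and \<open>up p\<close>, so \<open>f\<close> numbers the five chains
    \<open>p \<subseteq> up p\<close>.\<close>
  have "chain_colouring 5 (\<lambda>X. f (X \<inter> {1..4})) (P \<union> Q)"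
    unfolding chain_colouring_def
  proof (intro conjI ballI impI)
    have rep: "\<exists>p\<in>P. X \<inter> {1..4} = p \<and> (X = p \<or> X = up p)" if "X \<in> P \<union> Q" for X
      using that trace by (auto simp: Q_def)
    fix X assume X: "X \<in> P \<union> Q"
    show "f (X \<inter> {1..4}) < 5"
      using rep[OF X] f by (auto simp: bij_betw_def)
    fix Y assume Y: "Y \<in> P \<union> Q" and eq: "f (X \<inter> {1..4}) = f (Y \<inter> {1..4})"
    obtain p q where pq: "p \<in> P" "X \<inter> {1..4} = p" "X = p \<or> X = up p"
      "q \<in> P" "Y \<inter> {1..4} = q" "Y = q \<or> Y = up q"
      using rep[OF X] rep[OF Y] by blast
    then have "p = q"
      using f eq by (auto simp: bij_betw_def inj_on_def)
    then show "X \<subseteq> Y \<or> Y \<subseteq> X"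
      using pq(3,6) by (auto simp: up_def)
  qed
  then have "\<not> contains_antichain 6 (P \<union> Q)"
    using chain_colouring_imp_no_antichain[of 5] by simp
  then obtain F where F: "P \<union> Q \<subseteq> F" "antichain_saturated n 6 F"
    using ex_saturated_superset[OF sub] by blast
  note fin = saturated_finite[OF F(2)]
  have FP: "F \<subseteq> Pow {1..n}" and no: "\<not> contains_antichain 6 F"
    using F(2) unfolding antichain_saturated_def by blast+
  \<comment> \<open>Five sets on one level are pairwise incomparable, so a further set incomparable
    to all of them would be a sixth.\<close>
  have excluded: "X \<notin> F" if B: "B \<subseteq> level F i" "card B = 5" and X: "\<And>b. b \<in> B \<Longrightarrow> incomparable X b" for X B i
  proof
    assume "X \<in> F"
    have "X \<notin> B"
      using X by (auto simp: incomparable_def)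
    then have "card (insert X B) = 6"
      using B(2) by (simp add: card_ge_0_finite)
    moreover have "pairwise incomparable B"
      using pairwise_incomparable_level[OF fin(2)] B(1) by (rule pairwise_subset)
    then have "pairwise incomparable (insert X B)"
      using X by (auto simp: pairwise_insert incomparable_def)
    moreover have "insert X B \<subseteq> F"
      using B(1) \<open>X \<in> F\<close> by (auto simp: level_def)
    ultimately show False
      using no antichain_of_card_ge[of "insert X B" F 6] by simp
  qed
  have "level F 1 \<subseteq> (\<lambda>x. {x}) ` {1..4}"
  proof
    fix X assume X: "X \<in> level F 1"
    then obtain x where x: "X = {x}"
      by (auto simp: level_def card_1_singleton_iff)
    have "x \<le> 4"
    proof (rule ccontr)
      assume "\<not> x \<le> 4"
      then have "incomparable X p" if "p \<in> P" for p
        using p4[OF that] x card_mono[of "{x}" p] by (auto simp: incomparable_def)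
      moreover have "P \<subseteq> level F 2"
        using F(1) p4(3) by (auto simp: level_def)
      ultimately show False
        using excluded P(2) X by (auto simp: level_def)
    qed
    then show "X \<in> (\<lambda>x. {x}) ` {1..4}"
      using x X FP by (auto simp: level_def)
  qed
  then have "card (level F 1) \<le> card ((\<lambda>x. {x}) ` {1..4::nat})"
    by (intro card_mono) auto
  then have level1: "card (level F 1) \<le> 4"
    using card_image_le[of "{1..4::nat}" "\<lambda>x. {x}"] by simp
  have "level F (n - 1) \<subseteq> (\<lambda>x. {1..n} - {x}) ` {1..4}"
  proof
    fix X assume X: "X \<in> level F (n - 1)"
    then have Xn: "X \<subseteq> {1..n}" "finite X" "card X = n - 1"
      using FP fin(2) by (auto simp: level_def)
    then have "card ({1..n} - X) = 1"
      using n by (simp add: card_Diff_subset)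
    then obtain x where x: "{1..n} - X = {x}"
      using card_1_singletonE by blast
    then have X_eq: "X = {1..n} - {x}" and xn: "x \<in> {1..n}" "x \<notin> X"
      using Xn(1) by blast+
    have "x \<le> 4"
    proof (rule ccontr)
      assume "\<not> x \<le> 4"
      then have x_up: "x \<in> up p" for p
        using xn by (auto simp: up_def)
      have "incomparable X (up p)" if "p \<in> P" for p
      proof -
        have "finite (up p)"
          using p4(2)[OF that] by (simp add: up_def)
        then have "\<not> X \<subseteq> up p"
          using card_mono[of "up p" X] card_up[OF that] Xn(3) n by auto
        then show ?thesis
          using x_up xn(2) by (auto simp: incomparable_def)
      qed
      then have "incomparable X q" if "q \<in> Q" for q
        using that by (auto simp: Q_def)
      moreover have "Q \<subseteq> level F (n - 2)"
        using F(1) card_up by (auto simp: level_def Q_def)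
      ultimately show False
        using excluded cardQ X by (auto simp: level_def)
    qed
    then show "X \<in> (\<lambda>x. {1..n} - {x}) ` {1..4}"
      using X_eq xn(1) by auto
  qed
  then have "card (level F (n - 1)) \<le> card ((\<lambda>x. {1..n} - {x}) ` {1..4})"
    by (intro card_mono) auto
  then have level_n1: "card (level F (n - 1)) \<le> 4"
    using card_image_le[of "{1..4::nat}" "\<lambda>x. {1..n} - {x}"] by simp
  have "level F 0 \<subseteq> {{}}"
    using fin(2) by (auto simp: level_def)
  then have level0: "card (level F 0) \<le> 1"
    using card_mono[of "{{}}" "level F 0"] by simp
  have "X = {1..n}" if "X \<in> level F n" for X
    using that FP by (intro card_subset_eq) (auto simp: level_def)
  then have "level F n \<subseteq> {{1..n}}"
    by blast
  then have level_n: "card (level F n) \<le> 1"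
    using card_mono[of "{{1..n}}" "level F n"] by simp
  have "card (level F i) \<le> profile n i" for i
    using level0 level1 level_n level_n1 saturated_level_card_le[of n 5 F i] F(2)
    by (auto simp: profile_def)
  then have "(\<Sum>i\<le>n. card (level F i)) \<le> (\<Sum>i\<le>n. profile n i)"
    by (intro sum_mono)
  then have "card F \<le> 5 * n - 5"
    using sum_profile[OF n] card_eq_sum_levels[OF FP] by simp
  with F(2) show thesis
    by (rule that)
qed

theorem theorem3:
  fixes n :: nat
  assumes "n \<ge> 6"
  shows "sat_star n 6 = 5 * n - 5"
  unfolding sat_star_def
proof (rule Min_eqI[OF finite_saturated_sizes])
  obtain F where F: "antichain_saturated n 6 F" "card F \<le> 5 * n - 5"
    using ex_saturated_card_le[OF assms] .
  then have "card F = 5 * n - 5"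
    using saturated_card_ge[OF F(1) assms] by simp
  with F(1) show "5 * n - 5 \<in> {card F |F. antichain_saturated n 6 F}"
    by (metis (mono_tags, lifting) mem_Collect_eq)
qed (use saturated_card_ge[OF _ assms] in blast)

end
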